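(* Let $n,r\ge1$ and $0\le a\le 2n$ be integers. There is no circulant Hadamard matrix $X_C$ of order $4rn$ generated by a sequence $$X=(Y_1,Y_2,\dots,Y_{2r})\in\mathcal{G}_{2n}(a)\times\cdots\times\mathcal{G}_{2n}(a)\subset\mathcal{G}_{4nr}(2ar),$$ with $Y_i\in\mathcal{G}_{2n}(a)$ for all $i=1,\dots,2r$, if (1) $nr$ is odd and $\sum_{i=1}^{2r}\left(\tfrac12\omega(Y_iY_{i+1})+2a-2n\right)$ is even, or (2) $nr$ is even and $\sum_{i=1}^{2r}\left(\tfrac12\omega(Y_iY_{i+1})+2a-2n\right)$ is odd. Here $Y_{2r+1}=Y_1$.
   Context: $\mathbb{Z}_2=\{+,-\}=\{1,-1\}$ under multiplication, and $\mathbb{Z}_2^m$ is the group of $\pm1$ sequences of length $m$ under componentwise multiplication. $\omega(X)$ is the number of entries of $X\in\mathbb{Z}_2^m$ equal to $+$, and $\mathcal{G}_m(k)=\{X\in\mathbb{Z}_2^m:\omega(X)=k\}$. $(Y_1,\dots,Y_{2r})$ denotes concatenation. $C$ is the cyclic shift $C(x_0,\dots,x_{m-1})=(x_1,\dots,x_{m-1},x_0)$ and $X_C=\{C^i(X):0\le i<m\}$. $X_C$ is a circulant Hadamard matrix if the $m\times m$ circulant matrix whose rows are the cyclic shifts $C^i(X)$, $0\le i<m$, is a Hadamard matrix, i.e. a $\pm1$ matrix $H$ with $HH^t=mI_m$. *)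

theory Defs
  imports Main "Jordan_Normal_Form.Matrix"
begin

text \<open>Elements of $\mathbb{Z}_2^m$ are integer lists of length \<open>m\<close> with entries \<open>1\<close> and \<open>-1\<close>.\<close>

definition sign_seqs :: "nat \<Rightarrow> int list set" where
  "sign_seqs m = {X. length X = m \<and> set X \<subseteq> {1, -1}}"

definition seq_mult :: "int list \<Rightarrow> int list \<Rightarrow> int list" where
  "seq_mult X Y = map2 (*) X Y"

definition \<omega> :: "int list \<Rightarrow> nat" where
  "\<omega> X = card {i. i < length X \<and> X ! i = 1}"

definition \<G> :: "nat \<Rightarrow> nat \<Rightarrow> int list set" where
  "\<G> m k = {X \<in> sign_seqs m. \<omega> X = k}"

text \<open>The cyclic shift $C$ is \<^const>\<open>rotate1\<close>, and \<open>rotate i\<close> is its \<open>i\<close>-th iterate $C^i$.\<close>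

definition circulant_mat :: "int list \<Rightarrow> int mat" where
  "circulant_mat X = mat (length X) (length X) (\<lambda>(i, j). rotate i X ! j)"

definition hadamard_mat :: "nat \<Rightarrow> int mat \<Rightarrow> bool" where
  "hadamard_mat m H \<longleftrightarrow> H \<in> carrier_mat m m \<and> elements_mat H \<subseteq> {1, -1} \<and>
     H * H\<^sup>T = of_nat m \<cdot>\<^sub>m 1\<^sub>m m"

text \<open>The weight of the product of two sequences of even length and equal weight is even, so
  halving such a weight with \<open>div\<close> is exact.\<close>

lemma \<omega>_eq_sum_list:
  "set X \<subseteq> {1, -1} \<Longrightarrow> 2 * int (\<omega> X) = int (length X) + sum_list X"
proof (induction X)
  case Nil
  then show ?case by (simp add: \<omega>_def)
next
  case (Cons x X)
  have *: "{i. i < length (x # X) \<and> (x # X) ! i = 1} =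
      (if x = 1 then {0} else {}) \<union> Suc ` {i. i < length X \<and> X ! i = 1}"
    by (auto simp: less_Suc_eq_0_disj)
  have "\<omega> (x # X) = (if x = 1 then 1 else 0) + \<omega> X"
    unfolding \<omega>_def * by (subst card_Un_disjoint) (auto simp: card_image)
  with Cons show ?case by auto
qed

lemma sum_list_seq_mult_mod_4:
  assumes "length X = length Y" "set X \<subseteq> {1, -1}" "set Y \<subseteq> {1, -1}"
  shows "4 dvd sum_list (seq_mult X Y) - sum_list X - sum_list Y + int (length X)"
  using assms
proof (induction X Y rule: list_induct2)
  case Nil
  then show ?case by (simp add: seq_mult_def)
next
  case (Cons x X y Y)
  have IH: "4 dvd sum_list (seq_mult X Y) - sum_list X - sum_list Y + int (length X)"
    using Cons by simp
  have "4 dvd x * y - x - y + 1" using Cons.prems by auto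
  from dvd_add[OF this IH] show ?case
    by (simp add: seq_mult_def algebra_simps)
qed

lemma even_\<omega>_seq_mult:
  assumes "X \<in> \<G> (2 * n) a" "Y \<in> \<G> (2 * n) a"
  shows "even (\<omega> (seq_mult X Y))"
proof -
  have X: "length X = 2 * n" "set X \<subseteq> {1, -1}" "\<omega> X = a"
    and Y: "length Y = 2 * n" "set Y \<subseteq> {1, -1}" "\<omega> Y = a"
    using assms by (auto simp: \<G>_def sign_seqs_def)
  have "set (seq_mult X Y) \<subseteq> {1, -1}"
    using X(2) Y(2) by (fastforce simp: seq_mult_def dest: set_zip_leftD set_zip_rightD)
  from \<omega>_eq_sum_list[OF this] have
    "2 * int (\<omega> (seq_mult X Y)) = 2 * int n + sum_list (seq_mult X Y)"
    using X Y by (simp add: seq_mult_def)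
  moreover obtain k where
    "sum_list (seq_mult X Y) - sum_list X - sum_list Y + 2 * int n = 4 * k"
    using sum_list_seq_mult_mod_4[of X Y] X Y by (auto elim: dvdE)
  moreover have "sum_list X = 2 * int a - 2 * int n" "sum_list Y = 2 * int a - 2 * int n"
    using \<omega>_eq_sum_list[OF X(2)] \<omega>_eq_sum_list[OF Y(2)] X Y by simp_all
  ultimately have "int (\<omega> (seq_mult X Y)) = 2 * (k + int a - int n)"
    by (simp add: algebra_simps)
  then have "even (int (\<omega> (seq_mult X Y)))"
    by simp
  then show ?thesis by simp
qed

end

theory Submission imports Defs begin

text \<open>The shift \<open>C\<^sup>2\<^sup>n\<close> permutes the blocks of \<open>X\<close> cyclically, so orthogonality of the rows \<open>0\<close> and
  \<open>2n\<close> of the circulant matrix says that the weights \<open>\<omega>(Y\<^sub>iY\<^sub>i\<^sub>+\<^sub>1)\<close> add up to half the order,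
  namely \<open>2rn\<close>. Each of them is even, so their halves add up to \<open>rn\<close>, and the remaining terms
  \<open>2a - 2n\<close> are even: the sum in the theorem always has the parity of \<open>nr\<close>.\<close>

lemma set_seq_mult_subset:
  assumes "set X \<subseteq> {1, -1}" "set Y \<subseteq> {1, -1}"
  shows "set (seq_mult X Y) \<subseteq> {1, -1}"
  using assms by (fastforce simp: seq_mult_def dest: set_zip_leftD set_zip_rightD)

text \<open>Blocks of equal length keep the zipped lists aligned, so the inner product splits
  blockwise.\<close>

lemma sum_list_seq_mult_concat:
  assumes "\<And>i. i \<in> set xs \<Longrightarrow> length (f i) = length (g i)"
  shows "sum_list (seq_mult (concat (map f xs)) (concat (map g xs))) =
    (\<Sum>i\<leftarrow>xs. sum_list (seq_mult (f i) (g i)))"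
  using assms by (induction xs) (simp_all add: seq_mult_def)

text \<open>The inner product of row \<open>0\<close>, which is \<open>X\<close>, and row
  \<open>s\<close> is the entry \<open>(0, s)\<close> of the matrix times its transpose, off the
  diagonal as \<open>0 < s < m\<close>.\<close>

lemma hadamard_circulant_shift_orthogonal:
  assumes "hadamard_mat m (circulant_mat X)" "0 < s" "s < m"
  shows "sum_list (seq_mult X (rotate s X)) = 0"
proof -
  let ?H = "circulant_mat X"
  have H: "?H \<in> carrier_mat m m" "?H * ?H\<^sup>T = of_nat m \<cdot>\<^sub>m 1\<^sub>m m"
    using assms(1) by (auto simp: hadamard_mat_def)
  have len: "length X = m"
    using H(1) by (auto simp: circulant_mat_def)
  have "(?H * ?H\<^sup>T) $$ (0, s) = (of_nat m \<cdot>\<^sub>m 1\<^sub>m m) $$ (0, s)"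
    using H(2) by simp
  then have "(\<Sum>k = 0..<m. X ! k * rotate s X ! k) = 0"
    using assms(2,3) len by (simp add: circulant_mat_def scalar_prod_def)
  then show ?thesis
    by (simp add: seq_mult_def sum_list_sum_nth len)
qed

theorem theorem14:
  fixes n r a :: nat and Y :: "nat \<Rightarrow> int list" and X :: "int list"
  assumes "n \<ge> 1" and "r \<ge> 1" and "a \<le> 2 * n"
    and "\<And>i. i \<in> {1..2 * r} \<Longrightarrow> Y i \<in> \<G> (2 * n) a"
    and "Y (2 * r + 1) = Y 1"
    and "X = concat (map Y [1..<2 * r + 1])"
    and "(odd (n * r) \<and>
            even (\<Sum>i = 1..2 * r. (int (\<omega> (seq_mult (Y i) (Y (i + 1)))) div 2 + 2 * int a - 2 * int n))) \<or>
         (even (n * r) \<and>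
            odd (\<Sum>i = 1..2 * r. (int (\<omega> (seq_mult (Y i) (Y (i + 1)))) div 2 + 2 * int a - 2 * int n)))"
  shows "\<not> hadamard_mat (4 * r * n) (circulant_mat X)"
proof
  assume H: "hadamard_mat (4 * r * n) (circulant_mat X)"
  define w where "w i = int (\<omega> (seq_mult (Y i) (Y (i + 1))))" for i
  \<comment> \<open>The index \<open>2 * r + 1\<close> is included so that \<open>Y (i + 1)\<close>
    is covered also for \<open>i = 2 * r\<close>.\<close>
  have G: "Y i \<in> \<G> (2 * n) a" if "i \<in> {1..2 * r + 1}" for i
    using assms(4)[of i] assms(4)[of 1] assms(2,5) that by (cases "i = 2 * r + 1") auto
  then have len: "length (Y i) = 2 * n" and sgn: "set (Y i) \<subseteq> {1, -1}"
    if "i \<in> {1..2 * r + 1}" for i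
    using that by (auto simp: \<G>_def sign_seqs_def)
  have w_even: "even (w i)" if "i \<in> {1..2 * r}" for i
    using even_\<omega>_seq_mult[OF G G, of i "i + 1"] that by (simp add: w_def)
  have w_sum: "2 * w i = 2 * int n + sum_list (seq_mult (Y i) (Y (i + 1)))"
    if "i \<in> {1..2 * r}" for i
    using \<omega>_eq_sum_list[OF set_seq_mult_subset[OF sgn sgn, of i "i + 1"]]
      len[of i] len[of "i + 1"] that
    by (simp add: w_def seq_mult_def)
  \<comment> \<open>Rotating by the length of \<open>Y 1\<close> moves that block to the end, where
    it is read as \<open>Y (2 * r + 1)\<close>.\<close>
  have shift: "rotate (2 * n) X = concat (map (\<lambda>i. Y (i + 1)) [1..<2 * r + 1])"
  proof -
    have "X = Y 1 @ concat (map Y [2..<2 * r + 1])"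
      using assms(2,6) by (simp add: upt_conv_Cons numeral_2_eq_2)
    then have "rotate (2 * n) X = concat (map Y [2..<2 * r + 1]) @ Y (2 * r + 1)"
      using rotate_append[of "Y 1" "concat (map Y [2..<2 * r + 1])"] len[of 1] assms(5) by simp
    also have "\<dots> = concat (map Y [2..<2 * r + 2])"
      using assms(2) by simp
    also have "[2..<2 * r + 2] = map Suc [1..<2 * r + 1]"
      by (simp add: map_Suc_upt numeral_2_eq_2)
    finally show ?thesis by (simp add: o_def)
  qed
  \<comment> \<open>There are at least two blocks, so a shift by one block stays below the order and
    the orthogonality applies.\<close>
  have "2 * n < 4 * r * n"
    using assms(1,2) by simp
  then have "0 = sum_list (seq_mult X (rotate (2 * n) X))"
    using hadamard_circulant_shift_orthogonal[OF H, of "2 * n"] assms(1) by simp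
  also have "\<dots> = (\<Sum>i\<leftarrow>[1..<2 * r + 1]. sum_list (seq_mult (Y i) (Y (i + 1))))"
    unfolding shift unfolding assms(6) by (rule sum_list_seq_mult_concat) (subst (1 2) len; auto)
  also have "\<dots> = (\<Sum>i = 1..2 * r. sum_list (seq_mult (Y i) (Y (i + 1))))"
    by (simp only: interv_sum_list_conv_sum_set_nat set_upt)
      (simp only: Suc_eq_plus1[symmetric] atLeastLessThanSuc_atLeastAtMost)
  also have "\<dots> = (\<Sum>i = 1..2 * r. 2 * w i - 2 * int n)"
    by (rule sum.cong) (simp_all add: w_sum)
  finally have "(\<Sum>i = 1..2 * r. w i) = 2 * int (n * r)"
    by (simp add: sum_subtractf sum_distrib_left[symmetric])
  \<comment> \<open>Evenness of each \<open>w i\<close> makes \<open>div 2\<close> exact, so halving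
    commutes with the sum.\<close>
  moreover have "(\<Sum>i = 1..2 * r. w i) = 2 * (\<Sum>i = 1..2 * r. w i div 2)"
    unfolding sum_distrib_left by (rule sum.cong) (simp_all add: w_even)
  ultimately have "(\<Sum>i = 1..2 * r. w i div 2) = int (n * r)"
    by simp
  then have "(\<Sum>i = 1..2 * r. w i div 2 + 2 * int a - 2 * int n) =
      int (n * r) + 2 * (2 * int r * (int a - int n))"
    by (simp add: sum.distrib sum_subtractf algebra_simps)
  then have "even (\<Sum>i = 1..2 * r. w i div 2 + 2 * int a - 2 * int n) \<longleftrightarrow> even (n * r)"
    by simp
  then show False
    using assms(7) unfolding w_def by blast
qed

end
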